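(* Let $\Gamma$ be a strategic form game in which every action set $A_i$ is finite (with strategies the probability distributions on $A_i$ and payoffs the expected payoffs). Then a strategy profile $\sigma$ is a perfect equilibrium (defined via completely mixed nets of strategy profiles) if and only if there exists a sequence of strategy profiles $(\sigma^k)_{k=1}^\infty$ such that (D1) $\sigma^k$ has maximal carrier for each $k\in\mathbb N$; (D2) $\sigma^k\to\sigma$ as $k\to\infty$; and (D3) $\sigma$ is a best response to $\sigma^k$ for each $k\in\mathbb N$.
   Context: A directed set $(I,\le)$ is a non-empty set with a reflexive, transitive relation such that every pair has an upper bound and there is no maximal element (for every $\alpha$ there is $\beta\ge\alpha$ with $\beta\neq\alpha$). Nets are indexed by directed sets; convergence is as usual. The game: players $N=\{1,\dots,n\}$; finite non-empty action sets $A_i$, $A=\prod_iA_i$; $\mathcal F_i=2^{A_i}$; $\Sigma_i$ is the set of all probability measures on $A_i$ with its usual (Euclidean) topology, $\Sigma=\prod_i\Sigma_i$; $u_i\colon A\to\mathbb R$ and $U_i(\sigma)=\sum_{a\in A}\prod_j\sigma_j(a_j)\,u_i(a)$. $(\tau_i\mid\sigma)$ is the profile $\sigma$ with $\sigma_i$ replaced by $\tau_i$. $\tau_i\in\Sigma_i$ is a best response to $\sigma\in\Sigma$ if $U_i(\tau_i\mid\sigma)\ge U_i(\tau_i'\mid\sigma)$ for all $\tau_i'\in\Sigma_i$; a profile $\tau$ is a best response to $\sigma$ if each $\tau_i$ is. $\sigma$ is a Nash equilibrium if it is a best response to itself. The carrier of $\sigma_i\in\Sigma_i$ is $\mathcal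 C_i(\sigma_i)=\{E\in\mathcal F_i\mid\sigma_i(E)>0\}$, and $\mathcal C(\sigma)=\prod_i\mathcal C_i(\sigma_i)$. A carrier is a set of the form $\mathcal C(\sigma)$ with $\sigma\in\Sigma$. $\sigma_i$ has maximal carrier if $\mathcal C_i(\sigma_i)=\mathcal F_i\setminus\{\emptyset\}$; a profile has maximal carrier if each of its strategies does. A net $(\sigma_\alpha)_{\alpha\in I}$ in $\Sigma$ is completely mixed if for every carrier $\mathcal C$ there is $\alpha\in I$ with $\mathcal C\subseteq\mathcal C(\sigma_\beta)$ for all $\beta\ge\alpha$. $\sigma$ is perfect if there are a completely mixed net $(\sigma_\alpha)_{\alpha\in I}$ and a net $(\kappa_\alpha)_{\alpha\in I}$ in $\Sigma$, both converging to $\sigma$, such that $\kappa_\alpha$ is a best response to $\sigma_\alpha$ for each $\alpha\in I$. A perfect equilibrium is a Nash equilibrium that is perfect. *)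

theory Defs
  imports "HOL-Probability.Probability"
begin

text \<open>The relation \<^term>\<open>le\<close> is only a preorder on \<^term>\<open>I\<close>, and the last
  clause asks for a successor distinct from \<^term>\<open>\<alpha>\<close>, not for a strictly larger one.\<close>

definition directed_set :: "'ix set \<Rightarrow> ('ix \<Rightarrow> 'ix \<Rightarrow> bool) \<Rightarrow> bool" where
  "directed_set I le \<longleftrightarrow>
     I \<noteq> {} \<and> reflp_on I le \<and> transp_on I le \<and>
     (\<forall>\<alpha>\<in>I. \<forall>\<beta>\<in>I. \<exists>\<gamma>\<in>I. le \<alpha> \<gamma> \<and> le \<beta> \<gamma>) \<and>
     (\<forall>\<alpha>\<in>I. \<exists>\<beta>\<in>I. le \<alpha> \<beta> \<and> \<beta> \<noteq> \<alpha>)"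

definition net_converges ::
    "'b topology \<Rightarrow> 'ix set \<Rightarrow> ('ix \<Rightarrow> 'ix \<Rightarrow> bool) \<Rightarrow> ('ix \<Rightarrow> 'b) \<Rightarrow> 'b \<Rightarrow> bool" where
  "net_converges X I le f l \<longleftrightarrow>
     l \<in> topspace X \<and>
     (\<forall>U. openin X U \<and> l \<in> U \<longrightarrow> (\<exists>\<alpha>\<in>I. \<forall>\<beta>\<in>I. le \<alpha> \<beta> \<longrightarrow> f \<beta> \<in> U))"

text \<open>The players are \<^term>\<open>{1..n}\<close>. All action sets live in one type; a probability
  measure on the finite set \<^term>\<open>B\<close> is a \<^type>\<open>pmf\<close> concentrated on \<^term>\<open>B\<close>.
  Profiles are extensional functions on the set of players.\<close>

definition strategic_form_game :: "nat \<Rightarrow> (nat \<Rightarrow> 'a set) \<Rightarrow> bool" where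
  "strategic_form_game n A \<longleftrightarrow> (\<forall>i\<in>{1..n}. finite (A i) \<and> A i \<noteq> {})"

definition strategies :: "'a set \<Rightarrow> 'a pmf set" where
  "strategies B = {p. set_pmf p \<subseteq> B}"

definition profiles :: "nat \<Rightarrow> (nat \<Rightarrow> 'a set) \<Rightarrow> (nat \<Rightarrow> 'a pmf) set" where
  "profiles n A = (\<Pi>\<^sub>E i\<in>{1..n}. strategies (A i))"

text \<open>The Euclidean topology on the simplex over \<^term>\<open>B\<close>: a strategy is identified with
  the vector of its point masses in the product of copies of the real line indexed by
  \<^term>\<open>B\<close>.\<close>

definition strategy_topology :: "'a set \<Rightarrow> 'a pmf topology" where
  "strategy_topology B =
     pullback_topology (strategies B) (\<lambda>p. restrict (pmf p) B)
       (product_topology (\<lambda>_. euclideanreal) B)"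

definition profile_topology :: "nat \<Rightarrow> (nat \<Rightarrow> 'a set) \<Rightarrow> (nat \<Rightarrow> 'a pmf) topology" where
  "profile_topology n A = product_topology (\<lambda>i. strategy_topology (A i)) {1..n}"

definition expected_payoff ::
    "nat \<Rightarrow> (nat \<Rightarrow> 'a set) \<Rightarrow> (nat \<Rightarrow> (nat \<Rightarrow> 'a) \<Rightarrow> real) \<Rightarrow> nat \<Rightarrow> (nat \<Rightarrow> 'a pmf) \<Rightarrow> real" where
  "expected_payoff n A u i \<sigma> =
     (\<Sum>a\<in>(\<Pi>\<^sub>E j\<in>{1..n}. A j). (\<Prod>j\<in>{1..n}. pmf (\<sigma> j) (a j)) * u i a)"

definition player_best_response ::
    "nat \<Rightarrow> (nat \<Rightarrow> 'a set) \<Rightarrow> (nat \<Rightarrow> (nat \<Rightarrow> 'a) \<Rightarrow> real) \<Rightarrow> nat \<Rightarrow> 'a pmf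
       \<Rightarrow> (nat \<Rightarrow> 'a pmf) \<Rightarrow> bool" where
  "player_best_response n A u i t \<sigma> \<longleftrightarrow>
     t \<in> strategies (A i) \<and>
     (\<forall>t'\<in>strategies (A i).
        expected_payoff n A u i (\<sigma>(i := t)) \<ge> expected_payoff n A u i (\<sigma>(i := t')))"

definition best_response ::
    "nat \<Rightarrow> (nat \<Rightarrow> 'a set) \<Rightarrow> (nat \<Rightarrow> (nat \<Rightarrow> 'a) \<Rightarrow> real) \<Rightarrow> (nat \<Rightarrow> 'a pmf)
       \<Rightarrow> (nat \<Rightarrow> 'a pmf) \<Rightarrow> bool" where
  "best_response n A u \<tau> \<sigma> \<longleftrightarrow>
     \<tau> \<in> profiles n A \<and> (\<forall>i\<in>{1..n}. player_best_response n A u i (\<tau> i) \<sigma>)"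

definition nash_equilibrium ::
    "nat \<Rightarrow> (nat \<Rightarrow> 'a set) \<Rightarrow> (nat \<Rightarrow> (nat \<Rightarrow> 'a) \<Rightarrow> real) \<Rightarrow> (nat \<Rightarrow> 'a pmf) \<Rightarrow> bool" where
  "nash_equilibrium n A u \<sigma> \<longleftrightarrow> best_response n A u \<sigma> \<sigma>"

text \<open>A carrier consists of the events of positive probability; it is not the support.\<close>

definition strategy_carrier :: "'a set \<Rightarrow> 'a pmf \<Rightarrow> 'a set set" where
  "strategy_carrier B p = {E \<in> Pow B. measure_pmf.prob p E > 0}"

definition profile_carrier ::
    "nat \<Rightarrow> (nat \<Rightarrow> 'a set) \<Rightarrow> (nat \<Rightarrow> 'a pmf) \<Rightarrow> (nat \<Rightarrow> 'a set) set" where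
  "profile_carrier n A \<sigma> = (\<Pi>\<^sub>E i\<in>{1..n}. strategy_carrier (A i) (\<sigma> i))"

definition carriers :: "nat \<Rightarrow> (nat \<Rightarrow> 'a set) \<Rightarrow> (nat \<Rightarrow> 'a set) set set" where
  "carriers n A = profile_carrier n A ` profiles n A"

definition maximal_carrier :: "nat \<Rightarrow> (nat \<Rightarrow> 'a set) \<Rightarrow> (nat \<Rightarrow> 'a pmf) \<Rightarrow> bool" where
  "maximal_carrier n A \<sigma> \<longleftrightarrow> (\<forall>i\<in>{1..n}. strategy_carrier (A i) (\<sigma> i) = Pow (A i) - {{}})"

definition completely_mixed_net ::
    "nat \<Rightarrow> (nat \<Rightarrow> 'a set) \<Rightarrow> 'ix set \<Rightarrow> ('ix \<Rightarrow> 'ix \<Rightarrow> bool) \<Rightarrow> ('ix \<Rightarrow> nat \<Rightarrow> 'a pmf) \<Rightarrow> bool" where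
  "completely_mixed_net n A I le s \<longleftrightarrow>
     (\<forall>\<alpha>\<in>I. s \<alpha> \<in> profiles n A) \<and>
     (\<forall>C\<in>carriers n A. \<exists>\<alpha>\<in>I. \<forall>\<beta>\<in>I. le \<alpha> \<beta> \<longrightarrow> C \<subseteq> profile_carrier n A (s \<beta>))"

text \<open>HOL cannot quantify over all directed sets inside a formula, so the type from which
  index sets are drawn is a parameter. Index sets are arbitrary subsets of it with an arbitrary
  relation.\<close>

definition perfect ::
    "'ix itself \<Rightarrow> nat \<Rightarrow> (nat \<Rightarrow> 'a set) \<Rightarrow> (nat \<Rightarrow> (nat \<Rightarrow> 'a) \<Rightarrow> real) \<Rightarrow> (nat \<Rightarrow> 'a pmf)
       \<Rightarrow> bool" where
  "perfect (_ :: 'ix itself) n A u \<sigma> \<longleftrightarrow>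
     (\<exists>(I :: 'ix set) le s \<kappa>.
        directed_set I le \<and>
        completely_mixed_net n A I le s \<and>
        (\<forall>\<alpha>\<in>I. \<kappa> \<alpha> \<in> profiles n A) \<and>
        net_converges (profile_topology n A) I le s \<sigma> \<and>
        net_converges (profile_topology n A) I le \<kappa> \<sigma> \<and>
        (\<forall>\<alpha>\<in>I. best_response n A u (\<kappa> \<alpha>) (s \<alpha>)))"

definition perfect_equilibrium ::
    "'ix itself \<Rightarrow> nat \<Rightarrow> (nat \<Rightarrow> 'a set) \<Rightarrow> (nat \<Rightarrow> (nat \<Rightarrow> 'a) \<Rightarrow> real) \<Rightarrow> (nat \<Rightarrow> 'a pmf)
       \<Rightarrow> bool" where
  "perfect_equilibrium ix n A u \<sigma> \<longleftrightarrow> nash_equilibrium n A u \<sigma> \<and> perfect ix n A u \<sigma>"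

end

theory Submission
  imports Defs
begin

text \<open>A net converges along the filter generated by the tails of its index set, so both kinds
  of convergence become pointwise convergence of the finitely many point masses along a filter.
  If \<open>\<kappa>\<^sub>\<alpha>\<close> converges to \<open>\<sigma>\<close>, then eventually the support of \<open>\<kappa>\<^sub>\<alpha>\<close> contains that of \<open>\<sigma>\<close>; as payoffs
  are linear in a player's own strategy, \<open>\<sigma>\<close> is then itself a best response to \<open>\<sigma>\<^sub>\<alpha>\<close>. Comparison
  with the uniform profile shows that \<open>\<sigma>\<^sub>\<alpha>\<close> eventually has maximal carrier, and the sequence is
  extracted from the countably many conditions of closeness to \<open>\<sigma>\<close>. Conversely, the sequence
  together with the constant net \<open>\<sigma>\<close> witnesses perfection, and the Nash property follows from
  continuity of the payoffs.\<close>

section \<open>Convergence of nets and profiles\<close>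

definition net_filter :: "'ix set \<Rightarrow> ('ix \<Rightarrow> 'ix \<Rightarrow> bool) \<Rightarrow> 'ix filter" where
  "net_filter I le = (INF \<alpha>\<in>I. principal {\<beta> \<in> I. le \<alpha> \<beta>})"

text \<open>Upper bounds and transitivity make the tails a filter base: the tail of a common upper
  bound lies in both given tails, so a single tail decides membership.\<close>

lemma eventually_net_filter:
  assumes "directed_set I le"
  shows "eventually P (net_filter I le) \<longleftrightarrow> (\<exists>\<alpha>\<in>I. \<forall>\<beta>\<in>I. le \<alpha> \<beta> \<longrightarrow> P \<beta>)"
proof -
  have "\<exists>\<gamma>\<in>I. principal {\<delta> \<in> I. le \<gamma> \<delta>} \<le>
      inf (principal {\<delta> \<in> I. le \<alpha> \<delta>}) (principal {\<delta> \<in> I. le \<beta> \<delta>})"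
    if \<alpha>: "\<alpha> \<in> I" and \<beta>: "\<beta> \<in> I" for \<alpha> \<beta>
  proof -
    obtain \<gamma> where \<gamma>: "\<gamma> \<in> I" "le \<alpha> \<gamma>" "le \<beta> \<gamma>"
      using assms \<alpha> \<beta> unfolding directed_set_def by blast
    have "{\<delta> \<in> I. le \<gamma> \<delta>} \<subseteq> {\<delta> \<in> I. le \<alpha> \<delta>} \<inter> {\<delta> \<in> I. le \<beta> \<delta>}"
      using assms \<alpha> \<beta> \<gamma> unfolding directed_set_def by (blast dest: transp_onD)
    with \<gamma>(1) show ?thesis by auto
  qed
  moreover have "I \<noteq> {}"
    using assms by (simp add: directed_set_def)
  ultimately show ?thesis
    unfolding net_filter_def by (subst eventually_INF_base) (auto simp: eventually_principal)
qed

text \<open>By reflexivity each index lies in its own tail, so no tail is empty.\<close>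

lemma net_filter_neq_bot:
  assumes "directed_set I le"
  shows "net_filter I le \<noteq> bot"
proof -
  have "\<not> eventually (\<lambda>_. False) (net_filter I le)"
    unfolding eventually_net_filter[OF assms]
    using assms unfolding directed_set_def by (blast dest: reflp_onD)
  then show ?thesis
    by (simp add: trivial_limit_def)
qed

lemma net_converges_iff_limitin:
  assumes "directed_set I le"
  shows "net_converges X I le f l \<longleftrightarrow> limitin X f l (net_filter I le)"
  unfolding net_converges_def limitin_def eventually_net_filter[OF assms] by blast

lemma limitin_pullback_topology:
  "limitin (pullback_topology S g T) f l F \<longleftrightarrow>
     l \<in> S \<and> eventually (\<lambda>x. f x \<in> S) F \<and> limitin T (g \<circ> f) (g l) F" (is "?L \<longleftrightarrow> ?R")
proof
  assume L: ?L
  have l: "l \<in> S" "g l \<in> topspace T"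
    using limitin_topspace[OF L] by (auto simp: topspace_pullback_topology)
  have ev: "eventually (\<lambda>x. f x \<in> g -` U \<inter> S) F" if "openin T U" "g l \<in> U" for U
    using L that l unfolding limitin_def openin_pullback_topology by blast
  \<comment> \<open>Taking \<open>U\<close> to be all of \<open>topspace T\<close> isolates the
    membership in \<open>S\<close>.\<close>
  have "eventually (\<lambda>x. f x \<in> S) F"
    using ev[OF openin_topspace l(2)] by (rule eventually_mono) simp
  moreover have "eventually (\<lambda>x. (g \<circ> f) x \<in> U) F" if "openin T U" "g l \<in> U" for U
    using ev[OF that] by (rule eventually_mono) simp
  ultimately show ?R
    using l by (simp add: limitin_def)
next
  assume R: ?R
  then have "eventually (\<lambda>x. f x \<in> g -` U \<inter> S) F" if "openin T U" "g l \<in> U" for U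
    using that eventually_conj[of "\<lambda>x. f x \<in> S" F "\<lambda>x. (g \<circ> f) x \<in> U"]
    by (auto simp: limitin_def conj_commute)
  with R show ?L
    by (auto simp: limitin_def openin_pullback_topology topspace_pullback_topology)
qed

text \<open>The values of \<open>restrict\<close> are extensional, so the product topology adds
  nothing beyond the convergence of each point mass.\<close>

lemma limitin_strategy_topology:
  "limitin (strategy_topology B) f l F \<longleftrightarrow>
     l \<in> strategies B \<and> eventually (\<lambda>x. f x \<in> strategies B) F \<and>
     (\<forall>y\<in>B. ((\<lambda>x. pmf (f x) y) \<longlongrightarrow> pmf l y) F)"
  unfolding strategy_topology_def limitin_pullback_topology limitin_componentwise
  by simp

lemma topspace_strategy_topology: "topspace (strategy_topology B) = strategies B"
  by (auto simp: strategy_topology_def topspace_pullback_topology)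

lemma topspace_profile_topology: "topspace (profile_topology n A) = profiles n A"
  by (simp add: profile_topology_def profiles_def topspace_strategy_topology)

lemma limitin_profile_topology:
  "limitin (profile_topology n A) f l F \<longleftrightarrow>
     l \<in> profiles n A \<and> eventually (\<lambda>x. f x \<in> profiles n A) F \<and>
     (\<forall>i\<in>{1..n}. \<forall>y\<in>A i. ((\<lambda>x. pmf (f x i) y) \<longlongrightarrow> pmf (l i) y) F)" (is "?L \<longleftrightarrow> ?R")
proof
  assume L: ?L
  have "l \<in> profiles n A"
    using limitin_topspace[OF L] by (simp add: topspace_profile_topology)
  with L show ?R
    unfolding profile_topology_def limitin_componentwise limitin_strategy_topology
    by (simp add: topspace_strategy_topology profiles_def)
next
  assume R: ?R
  then have "eventually (\<lambda>x. f x i \<in> strategies (A i)) F" if "i \<in> {1..n}" for i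
    using that by (auto simp: profiles_def elim!: eventually_mono)
  with R show ?L
    unfolding profile_topology_def limitin_componentwise limitin_strategy_topology
    by (auto simp: topspace_strategy_topology profiles_def PiE_iff)
qed

section \<open>Expected payoffs\<close>

lemma tendsto_expected_payoff:
  assumes "\<And>j y. j \<in> {1..n} \<Longrightarrow> y \<in> A j \<Longrightarrow> ((\<lambda>x. pmf (f x j) y) \<longlongrightarrow> pmf (l j) y) F"
  shows "((\<lambda>x. expected_payoff n A u i (f x)) \<longlongrightarrow> expected_payoff n A u i l) F"
  unfolding expected_payoff_def
  by (intro tendsto_sum tendsto_mult tendsto_prod tendsto_const assms) auto

text \<open>Each summand splits into the factor of player \<open>i\<close> and a weight
  \<open>w a\<close> that does not depend on that player's strategy. After exchanging the sums,
  \<open>return_pmf x\<close> keeps only the profiles with \<open>a i = x\<close>.\<close>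

lemma expected_payoff_linear:
  assumes "strategic_form_game n A" and i: "i \<in> {1..n}"
  shows "expected_payoff n A u i (\<sigma>(i := p)) =
    (\<Sum>x\<in>A i. pmf p x * expected_payoff n A u i (\<sigma>(i := return_pmf x)))"
proof -
  define w where "w a = (\<Prod>j\<in>{1..n} - {i}. pmf (\<sigma> j) (a j)) * u i a" for a
  have fin: "finite (A i)"
    using assms by (simp add: strategic_form_game_def)
  have eq: "expected_payoff n A u i (\<sigma>(i := q)) =
      (\<Sum>a\<in>(\<Pi>\<^sub>E j\<in>{1..n}. A j). pmf q (a i) * w a)" for q
  proof -
    have "(\<Prod>j\<in>{1..n}. pmf ((\<sigma>(i := q)) j) (a j)) =
        pmf q (a i) * (\<Prod>j\<in>{1..n} - {i}. pmf (\<sigma> j) (a j))" for a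
      using i by (subst prod.remove[of _ i]) (auto intro!: prod.cong)
    then show ?thesis
      unfolding expected_payoff_def w_def by (simp add: mult.assoc)
  qed
  have "(\<Sum>x\<in>A i. pmf p x * expected_payoff n A u i (\<sigma>(i := return_pmf x))) =
      (\<Sum>a\<in>(\<Pi>\<^sub>E j\<in>{1..n}. A j). \<Sum>x\<in>A i. pmf p x * (pmf (return_pmf x) (a i) * w a))"
    unfolding eq sum_distrib_left by (rule sum.swap)
  also have "\<dots> = (\<Sum>a\<in>(\<Pi>\<^sub>E j\<in>{1..n}. A j). pmf p (a i) * w a)"
  proof (rule sum.cong[OF refl])
    fix a assume "a \<in> (\<Pi>\<^sub>E j\<in>{1..n}. A j)"
    then have "a i \<in> A i"
      using i by auto
    moreover have "(\<Sum>x\<in>A i. pmf p x * (pmf (return_pmf x) (a i) * w a)) =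
        (\<Sum>x\<in>A i. if x = a i then pmf p x * w a else 0)"
      by (rule sum.cong) auto
    ultimately show "(\<Sum>x\<in>A i. pmf p x * (pmf (return_pmf x) (a i) * w a)) = pmf p (a i) * w a"
      using fin by simp
  qed
  finally show ?thesis
    by (simp add: eq)
qed

text \<open>Every pure action in the support of an optimal strategy is itself optimal, so any
  mixture of such actions earns the same payoff.\<close>

lemma player_best_response_subset_support:
  assumes game: "strategic_form_game n A" and i: "i \<in> {1..n}"
    and best: "player_best_response n A u i t \<sigma>"
    and supp: "set_pmf t' \<subseteq> set_pmf t"
  shows "player_best_response n A u i t' \<sigma>"
proof -
  define U where "U q = expected_payoff n A u i (\<sigma>(i := q))" for q
  have fin: "finite (A i)"
    using game i by (simp add: strategic_form_game_def)
  have t: "set_pmf t \<subseteq> A i" and max: "\<And>q. set_pmf q \<subseteq> A i \<Longrightarrow> U q \<le> U t"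
    using best by (auto simp: player_best_response_def strategies_def U_def)
  have lin: "U q = (\<Sum>x\<in>A i. pmf q x * U (return_pmf x))" for q
    unfolding U_def by (rule expected_payoff_linear[OF game i])
  have total: "(\<Sum>x\<in>A i. pmf q x * (U t - U (return_pmf x))) = U t - U q"
    if "set_pmf q \<subseteq> A i" for q
    using sum_pmf_eq_1[OF fin that]
    by (simp add: right_diff_distrib sum_subtractf lin[symmetric] sum_distrib_right[symmetric])
  \<comment> \<open>For \<open>q = t\<close> the shortfalls average to zero, and none is negative
    because \<open>t\<close> is optimal; hence each weighted term vanishes.\<close>
  have "\<forall>x\<in>A i. pmf t x * (U t - U (return_pmf x)) = 0"
    using total[OF t] max by (subst sum_nonneg_eq_0_iff[OF fin, symmetric]) auto
  \<comment> \<open>On the support of \<open>t\<close> the shortfall is zero; off it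
    \<open>t'\<close> has no mass either.\<close>
  then have "pmf t' x * (U t - U (return_pmf x)) = 0" if "x \<in> A i" for x
    using supp that by (cases "x \<in> set_pmf t") (auto simp: set_pmf_iff)
  then have "(\<Sum>x\<in>A i. pmf t' x * (U t - U (return_pmf x))) = 0"
    by (intro sum.neutral) blast
  then have "U t - U t' = 0"
    unfolding total[OF subset_trans[OF supp t]] .
  then show ?thesis
    using t supp max by (auto simp: player_best_response_def strategies_def U_def)
qed

text \<open>The reply \<tau> stays fixed while the profile varies, so weak payoff inequalities
  against each fixed deviation pass to the limit by continuity.\<close>

lemma best_response_limit:
  assumes F: "F \<noteq> bot" and lim: "limitin (profile_topology n A) s \<sigma> F"
    and best: "eventually (\<lambda>x. best_response n A u \<tau> (s x)) F"
  shows "best_response n A u \<tau> \<sigma>"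
proof -
  have "\<tau> \<in> profiles n A"
    using eventually_happens'[OF F best] by (auto simp: best_response_def)
  moreover have "expected_payoff n A u i (\<sigma>(i := t')) \<le> expected_payoff n A u i (\<sigma>(i := \<tau> i))"
    if i: "i \<in> {1..n}" and t': "t' \<in> strategies (A i)" for i t'
  proof (rule tendsto_le[OF F])
    show "((\<lambda>x. expected_payoff n A u i ((s x)(i := t))) \<longlongrightarrow>
        expected_payoff n A u i (\<sigma>(i := t))) F" for t
      using lim by (intro tendsto_expected_payoff) (auto simp: limitin_profile_topology)
    then show "((\<lambda>x. expected_payoff n A u i ((s x)(i := t'))) \<longlongrightarrow>
        expected_payoff n A u i (\<sigma>(i := t'))) F" .
    show "eventually (\<lambda>x. expected_payoff n A u i ((s x)(i := t')) \<le>
        expected_payoff n A u i ((s x)(i := \<tau> i))) F"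
      using best by (rule eventually_mono)
        (use i t' in \<open>auto simp: best_response_def player_best_response_def\<close>)
  qed
  ultimately show ?thesis
    by (auto simp: best_response_def player_best_response_def profiles_def)
qed

lemma eventually_best_response_limit:
  assumes game: "strategic_form_game n A"
    and lim: "limitin (profile_topology n A) \<kappa> \<sigma> F"
    and best: "eventually (\<lambda>x. best_response n A u (\<kappa> x) (s x)) F"
  shows "eventually (\<lambda>x. best_response n A u \<sigma> (s x)) F"
proof -
  have \<sigma>: "\<sigma> \<in> profiles n A"
    using lim by (simp add: limitin_profile_topology)
  \<comment> \<open>Only finitely many pairs of a player and a supported action occur, so their
    separate eventual conditions hold together.\<close>
  have "eventually (\<lambda>x. \<forall>i\<in>{1..n}. \<forall>y\<in>set_pmf (\<sigma> i). 0 < pmf (\<kappa> x i) y) F"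
  proof (intro eventually_ball_finite ballI)
    fix i assume i: "i \<in> {1..n}"
    then have sub: "set_pmf (\<sigma> i) \<subseteq> A i"
      using \<sigma> by (auto simp: profiles_def strategies_def)
    then show "finite (set_pmf (\<sigma> i))"
      using game i by (auto simp: strategic_form_game_def intro: finite_subset)
    fix y assume y: "y \<in> set_pmf (\<sigma> i)"
    with lim sub i have "((\<lambda>x. pmf (\<kappa> x i) y) \<longlongrightarrow> pmf (\<sigma> i) y) F"
      by (auto simp: limitin_profile_topology)
    then show "eventually (\<lambda>x. 0 < pmf (\<kappa> x i) y) F"
      using pmf_positive[OF y] by (rule order_tendstoD(1))
  qed simp
  with best show ?thesis
  proof eventually_elim
    case (elim x)
    have "player_best_response n A u i (\<sigma> i) (s x)" if i: "i \<in> {1..n}" for i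
    proof (rule player_best_response_subset_support[OF game i])
      show "player_best_response n A u i (\<kappa> x i) (s x)"
        using elim(1) i by (simp add: best_response_def)
      show "set_pmf (\<sigma> i) \<subseteq> set_pmf (\<kappa> x i)"
        using elim(2) i by (force simp: set_pmf_iff)
    qed
    with \<sigma> show ?case
      by (simp add: best_response_def)
  qed
qed

section \<open>Carriers\<close>

lemma strategy_carrier_altdef: "strategy_carrier B p = {E \<in> Pow B. set_pmf p \<inter> E \<noteq> {}}"
  by (auto simp: strategy_carrier_def zero_less_measure_iff measure_pmf_zero_iff)

lemma strategy_carrier_subset: "strategy_carrier B p \<subseteq> Pow B - {{}}"
  by (auto simp: strategy_carrier_altdef)

text \<open>No carrier contains the empty event, so a maximal carrier includes every other one and
  any index serves as threshold.\<close>

lemma completely_mixed_net_of_maximal_carrier: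
  assumes "I \<noteq> {}" and "\<And>\<alpha>. \<alpha> \<in> I \<Longrightarrow> s \<alpha> \<in> profiles n A"
    and "\<And>\<alpha>. \<alpha> \<in> I \<Longrightarrow> maximal_carrier n A (s \<alpha>)"
  shows "completely_mixed_net n A I le s"
proof -
  have "C \<subseteq> profile_carrier n A (s \<beta>)" if C: "C \<in> carriers n A" and "\<beta> \<in> I" for C \<beta>
  proof -
    obtain \<tau> where \<tau>: "C = profile_carrier n A \<tau>"
      using C by (auto simp: carriers_def)
    have "strategy_carrier (A i) (\<tau> i) \<subseteq> strategy_carrier (A i) (s \<beta> i)"
      if "i \<in> {1..n}" for i
      using strategy_carrier_subset assms(3)[OF \<open>\<beta> \<in> I\<close>] that by (auto simp: maximal_carrier_def)
    then show ?thesis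
      unfolding \<tau> profile_carrier_def by (rule PiE_mono)
  qed
  with assms show ?thesis
    unfolding completely_mixed_net_def by blast
qed

lemma completely_mixed_net_eventually_maximal_carrier:
  assumes game: "strategic_form_game n A" and I: "directed_set I le"
    and mixed: "completely_mixed_net n A I le s"
  shows "eventually (\<lambda>\<alpha>. maximal_carrier n A (s \<alpha>)) (net_filter I le)"
proof -
  define \<tau> where "\<tau> = (\<lambda>i\<in>{1..n}. pmf_of_set (A i))"
  have \<tau>: "set_pmf (\<tau> i) = A i" if "i \<in> {1..n}" for i
    using game that by (simp add: \<tau>_def strategic_form_game_def)
  have "\<tau> \<in> profiles n A"
    using \<tau> by (auto simp: profiles_def strategies_def \<tau>_def)
  then have "profile_carrier n A \<tau> \<in> carriers n A"
    by (simp add: carriers_def)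
  with mixed have "eventually (\<lambda>\<beta>. profile_carrier n A \<tau> \<subseteq> profile_carrier n A (s \<beta>))
      (net_filter I le)"
    by (simp add: eventually_net_filter[OF I] completely_mixed_net_def)
  then show ?thesis
  proof (rule eventually_mono)
    fix \<beta> assume sub: "profile_carrier n A \<tau> \<subseteq> profile_carrier n A (s \<beta>)"
    have carrier_\<tau>: "strategy_carrier (A i) (\<tau> i) = Pow (A i) - {{}}" if "i \<in> {1..n}" for i
      using \<tau>[OF that] by (auto simp: strategy_carrier_altdef)
    \<comment> \<open>An inclusion of products passes to the factors only if the smaller product is
      non-empty; the full event \<open>A i\<close> provides a member of each factor.\<close>
    moreover have "A i \<in> Pow (A i) - {{}}" if "i \<in> {1..n}" for i
      using game that by (auto simp: strategic_form_game_def)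
    ultimately have "\<forall>i\<in>{1..n}. strategy_carrier (A i) (\<tau> i) \<noteq> {}"
      by (metis empty_iff)
    then have "\<forall>i\<in>{1..n}. strategy_carrier (A i) (\<tau> i) \<subseteq> strategy_carrier (A i) (s \<beta> i)"
      using sub by (auto simp: profile_carrier_def subset_PiE PiE_eq_empty_iff)
    then show "maximal_carrier n A (s \<beta>)"
      using carrier_\<tau> strategy_carrier_subset unfolding maximal_carrier_def by blast
  qed
qed

section \<open>Nets and sequences\<close>

text \<open>\<open>perfect\<close> draws its index sets from one fixed type, so a sequence becomes a
  net by carrying the order of the naturals over to an injective copy in that type.\<close>

lemma directed_set_range_nat:
  fixes h :: "nat \<Rightarrow> 'ix"
  assumes "inj h"
  shows "directed_set (range h) (\<lambda>\<alpha> \<beta>. inv h \<alpha> \<le> inv h \<beta>)"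
proof -
  have "\<exists>\<gamma>\<in>range h. k \<le> inv h \<gamma> \<and> l \<le> inv h \<gamma>" for k l
    by (rule bexI[of _ "h (max k l)"]) (simp_all add: assms)
  moreover have "\<exists>\<gamma>\<in>range h. k \<le> inv h \<gamma> \<and> \<gamma> \<noteq> h k" for k
    by (rule bexI[of _ "h (Suc k)"]) (simp_all add: assms inj_eq)
  ultimately show ?thesis
    using assms unfolding directed_set_def
    by (auto simp: reflp_on_def transp_on_def)
qed

lemma net_converges_range_nat:
  fixes h :: "nat \<Rightarrow> 'ix"
  assumes "inj h"
  shows "net_converges X (range h) (\<lambda>\<alpha> \<beta>. inv h \<alpha> \<le> inv h \<beta>) (\<lambda>\<alpha>. f (inv h \<alpha>)) l \<longleftrightarrow>
    limitin X f l sequentially"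
  using assms by (simp add: net_converges_def limitin_def eventually_sequentially)

text \<open>For each \<open>k\<close>, finitely many eventual conditions hold jointly, and a proper
  filter supplies a point \<open>r k\<close> satisfying them. The points are chosen independently;
  the bound \<open>inverse (Suc k)\<close> alone forces convergence.\<close>

lemma limitin_profile_topology_sequence:
  assumes game: "strategic_form_game n A" and F: "F \<noteq> bot"
    and lim: "limitin (profile_topology n A) s \<sigma> F" and P: "eventually P F"
  shows "\<exists>r :: nat \<Rightarrow> 'x. (\<forall>k. P (r k) \<and> s (r k) \<in> profiles n A) \<and>
    limitin (profile_topology n A) (\<lambda>k. s (r k)) \<sigma> sequentially"
proof -
  have "\<exists>x. P x \<and> s x \<in> profiles n A \<and>
      (\<forall>i\<in>{1..n}. \<forall>y\<in>A i. dist (pmf (s x i) y) (pmf (\<sigma> i) y) < inverse (Suc k))" for k :: nat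
  proof (rule eventually_happens'[OF F], intro eventually_conj eventually_ball_finite ballI P)
    show "eventually (\<lambda>x. s x \<in> profiles n A) F"
      using lim by (simp add: limitin_profile_topology)
    show "finite (A i)" if "i \<in> {1..n}" for i
      using game that by (simp add: strategic_form_game_def)
    show "eventually (\<lambda>x. dist (pmf (s x i) y) (pmf (\<sigma> i) y) < inverse (Suc k)) F"
      if "i \<in> {1..n}" "y \<in> A i" for i y
      using lim that by (intro tendstoD) (auto simp: limitin_profile_topology)
  qed simp
  then have "\<exists>r. \<forall>k. P (r k) \<and> s (r k) \<in> profiles n A \<and>
      (\<forall>i\<in>{1..n}. \<forall>y\<in>A i. dist (pmf (s (r k) i) y) (pmf (\<sigma> i) y) < inverse (Suc k))"
    by (intro choice allI)
  then obtain r where r: "\<And>k. P (r k)" "\<And>k. s (r k) \<in> profiles n A"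
    and close: "\<And>k i y. i \<in> {1..n} \<Longrightarrow> y \<in> A i \<Longrightarrow>
      dist (pmf (s (r k) i) y) (pmf (\<sigma> i) y) < inverse (real (Suc k))"
    by blast
  have "(\<lambda>k. pmf (s (r k) i) y) \<longlonglongrightarrow> pmf (\<sigma> i) y" if "i \<in> {1..n}" "y \<in> A i" for i y
  proof (rule tendstoI)
    fix e :: real assume "0 < e"
    have "eventually (\<lambda>k. inverse (real (Suc k)) < e) sequentially"
      using order_tendstoD(2)[OF LIMSEQ_inverse_real_of_nat \<open>0 < e\<close>] .
    then show "eventually (\<lambda>k. dist (pmf (s (r k) i) y) (pmf (\<sigma> i) y) < e) sequentially"
      by (rule eventually_mono) (rule less_trans[OF close[OF that]])
  qed
  then have "limitin (profile_topology n A) (\<lambda>k. s (r k)) \<sigma> sequentially"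
    using lim r by (simp add: limitin_profile_topology)
  with r show ?thesis
    by blast
qed

theorem theorem31:
  fixes n :: nat
    and A :: "nat \<Rightarrow> 'a set"
    and u :: "nat \<Rightarrow> (nat \<Rightarrow> 'a) \<Rightarrow> real"
    and \<sigma> :: "nat \<Rightarrow> 'a pmf"
  assumes "strategic_form_game n A"
    and "\<sigma> \<in> profiles n A"
    and "infinite (UNIV :: 'ix set)"
  shows "perfect_equilibrium TYPE('ix) n A u \<sigma> \<longleftrightarrow>
    (\<exists>s :: nat \<Rightarrow> nat \<Rightarrow> 'a pmf.
       (\<forall>k\<ge>1. s k \<in> profiles n A) \<and>
       (\<forall>k\<ge>1. maximal_carrier n A (s k)) \<and>
       limitin (profile_topology n A) s \<sigma> sequentially \<and>
       (\<forall>k\<ge>1. best_response n A u \<sigma> (s k)))"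
    (is "?perfect \<longleftrightarrow> (\<exists>s. ?D s)")
proof
  assume ?perfect
  then obtain I :: "'ix set" and le s \<kappa> where I: "directed_set I le"
    and mixed: "completely_mixed_net n A I le s"
    and s: "net_converges (profile_topology n A) I le s \<sigma>"
    and \<kappa>: "net_converges (profile_topology n A) I le \<kappa> \<sigma>"
    and best: "\<forall>\<alpha>\<in>I. best_response n A u (\<kappa> \<alpha>) (s \<alpha>)"
    unfolding perfect_equilibrium_def perfect_def by blast
  have "eventually (\<lambda>\<alpha>. best_response n A u (\<kappa> \<alpha>) (s \<alpha>)) (net_filter I le)"
    using best I unfolding eventually_net_filter[OF I] directed_set_def by blast
  with assms(1) \<kappa> have "eventually (\<lambda>\<alpha>. best_response n A u \<sigma> (s \<alpha>)) (net_filter I le)"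
    unfolding net_converges_iff_limitin[OF I] by (rule eventually_best_response_limit)
  then have "eventually (\<lambda>\<alpha>. maximal_carrier n A (s \<alpha>) \<and> best_response n A u \<sigma> (s \<alpha>))
      (net_filter I le)"
    using completely_mixed_net_eventually_maximal_carrier[OF assms(1) I mixed]
    by (rule eventually_conj[rotated])
  from limitin_profile_topology_sequence[OF assms(1) net_filter_neq_bot[OF I]
      s[unfolded net_converges_iff_limitin[OF I]] this]
  obtain r where r: "\<forall>k. (maximal_carrier n A (s (r k)) \<and> best_response n A u \<sigma> (s (r k))) \<and>
        s (r k) \<in> profiles n A"
      "limitin (profile_topology n A) (\<lambda>k. s (r k)) \<sigma> sequentially"
    by (elim exE conjE)
  show "\<exists>s. ?D s"
    by (rule exI[of _ "\<lambda>k. s (r k)"]) (simp add: r)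
next
  assume "\<exists>s. ?D s"
  then obtain s where s: "?D s" ..
  then have lim: "limitin (profile_topology n A) s \<sigma> sequentially"
    and best: "\<And>k. k \<ge> 1 \<Longrightarrow> best_response n A u \<sigma> (s k)"
    by blast+
  \<comment> \<open>The Nash property: \<sigma> is a best response to every \<open>s k\<close> with
    \<open>k \<ge> 1\<close>, hence to their limit.\<close>
  have "best_response n A u \<sigma> \<sigma>"
    using sequentially_bot lim
    by (rule best_response_limit) (use best in \<open>auto simp: eventually_sequentially\<close>)
  \<comment> \<open>Infinitude of the index type gives room for a copy of the naturals.\<close>
  moreover obtain h :: "nat \<Rightarrow> 'ix" where h: "inj h"
    using infinite_countable_subset[OF assms(3)] by blast
  define le where "le = (\<lambda>\<alpha> \<beta>. inv h \<alpha> \<le> inv h \<beta>)"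
  \<comment> \<open>The conditions on \<open>s\<close> start at index 1, whereas the copied order
    starts at 0; \<open>Suc\<close> skips the unconstrained term \<open>s 0\<close>.\<close>
  define t where "t = (\<lambda>\<alpha>. s (Suc (inv h \<alpha>)))"
  have "directed_set (range h) le"
    unfolding le_def by (rule directed_set_range_nat[OF h])
  moreover have "completely_mixed_net n A (range h) le t"
    using s by (intro completely_mixed_net_of_maximal_carrier) (auto simp: t_def)
  moreover have "net_converges (profile_topology n A) (range h) le t \<sigma>"
    unfolding le_def t_def net_converges_range_nat[OF h, of _ "\<lambda>k. s (Suc k)"]
    using limitin_sequentially_offset[OF lim, of 1] by simp
  \<comment> \<open>The net of replies can be constant, since \<sigma> itself answers every
    \<open>t \<alpha>\<close> optimally.\<close>
  moreover have "net_converges (profile_topology n A) (range h) le (\<lambda>_. \<sigma>) \<sigma>"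
    using assms(2) unfolding net_converges_def topspace_profile_topology by blast
  moreover have "best_response n A u \<sigma> (t \<alpha>)" for \<alpha>
    unfolding t_def by (rule best) simp
  ultimately show ?perfect
    using assms(2) unfolding perfect_equilibrium_def nash_equilibrium_def perfect_def
    by (intro conjI exI[of _ "range h"] exI[of _ le] exI[of _ t] exI[of _ "\<lambda>_. \<sigma>"] ballI)
qed

end
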